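(* Let $\mathcal A=\langle A;\Xi\rangle$ be an algebra and $f\colon A\to A$. Then each of the following four pairs consists of equivalent conditions: (1) $f$ is $\mathcal A$-stable-preorder preserving $\iff$ $f^{-1}(L)\in \mathrm{Latt}^{\infty}_{\mathcal A}(L)$ for every $L\subseteq A$; (2) $f$ preserves every finite index $\mathcal A$-stable preorder $\iff$ $f^{-1}(L)\in \mathrm{Latt}^{\emptyset,A}_{\mathcal A}(L)$ for every $\mathcal A$-recognizable $L\subseteq A$; (3) $f$ is $\mathcal A$-congruence preserving $\iff$ $f^{-1}(L)\in \mathrm{Bool}^{\infty}_{\mathcal A}(L)$ for every $L\subseteq A$; (4) $f$ preserves every finite index $\mathcal A$-congruence $\iff$ $f^{-1}(L)\in \mathrm{Bool}^{\emptyset,A}_{\mathcal A}(L)$ for every $\mathcal A$-recognizable $L\subseteq A$. Moreover, the first condition of (1) implies the first conditions of (2) and (3), and each of these implies the first condition of (4).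
   Context: An algebra $\mathcal A=\langle A;\Xi\rangle$ is a nonempty set $A$ with a set $\Xi$ of operations $\xi\colon A^{ar(\xi)}\to A$. A binary relation $\rho$ on $A$ is compatible with $g\colon A^p\to A$ if $x_1\rho y_1,\dots,x_p\rho y_p$ imply $g(x_1,\dots,x_p)\,\rho\, g(y_1,\dots,y_p)$. $\rho$ is $\mathcal A$-stable if it is compatible with every $\xi\in\Xi$. An $\mathcal A$-congruence is an $\mathcal A$-stable equivalence relation; an $\mathcal A$-stable preorder is an $\mathcal A$-stable reflexive transitive relation. $f$ is $\mathcal A$-congruence preserving (resp. $\mathcal A$-stable-preorder preserving) if every $\mathcal A$-congruence (resp. every $\mathcal A$-stable preorder) is compatible with $f$. The index of a congruence is its number of classes; the index of a stable preorder $\sqsubseteq$ is the index of the congruence $\{(x,y): x\sqsubseteq y \text{ and } y\sqsubseteq x\}$. A set $L\subseteq A$ is $\mathcal A$-recognizable if it is a union of classes of some finite index $\mathcal A$-congruence. The 1-freezifications of an operation $\xi$ of arity $n\ge 2$ are the unary maps $x\mapsto \xi(c_1,\dots,c_{i-1},x,c_{i+1},\dots,c_n)$ for $1\le i\le n$ and $c_j\in A$; a unary operation is its own sole 1-freezification. $\mathrm{Freez}^*(\mathcal A)$ is the set of all compositions of finite (possibly empty, giving the identity) sequences of 1-freezifications of operations in $\Xi$. For $L\subseteq A$: $\mathrm{Latt}^{\emptyset,A}_{\mathcal A}(L)$ is the smallest family of subsets of $A$ containing $L,\emptyset,A$, closed under finite unions and intersections and under $X\mapsto\gamma^{-1}(X)$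 for all $\gamma\in\mathrm{Freez}^*(\mathcal A)$; $\mathrm{Latt}^{\infty}_{\mathcal A}(L)$ is the smallest family containing $L$, closed under arbitrary (including empty and infinite) unions and intersections and under all $\gamma^{-1}$; $\mathrm{Bool}^{\emptyset,A}_{\mathcal A}(L)$ is the smallest family containing $L,\emptyset,A$ closed under finite unions, intersections, complementation and all $\gamma^{-1}$; $\mathrm{Bool}^{\infty}_{\mathcal A}(L)$ is the smallest family containing $L$ closed under arbitrary unions and intersections, complementation and all $\gamma^{-1}$. *)

theory Defs
  imports Main "HOL-Library.FuncSet"
begin

text \<open>
  An operation is a pair of its arity and a function on argument lists; only the values on
  lists of that length over the carrier matter. Nullary operations are allowed.
\<close>

type_synonym 'a operation = "nat \<times> ('a list \<Rightarrow> 'a)"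

definition tuples :: "'a set \<Rightarrow> nat \<Rightarrow> 'a list set" where
  "tuples A n = {xs. length xs = n \<and> set xs \<subseteq> A}"

locale univ_algebra =
  fixes A :: "'a set" and \<Xi> :: "'a operation set"
  assumes nonempty: "A \<noteq> {}"
    and closed: "(n, \<xi>) \<in> \<Xi> \<Longrightarrow> \<xi> \<in> tuples A n \<rightarrow> A"

definition unary_op :: "('a \<Rightarrow> 'a) \<Rightarrow> 'a operation" where
  "unary_op f = (1, \<lambda>xs. f (hd xs))"

definition compatible :: "'a set \<Rightarrow> ('a \<times> 'a) set \<Rightarrow> 'a operation \<Rightarrow> bool" where
  "compatible A \<rho> g \<longleftrightarrow>
     (\<forall>xs \<in> tuples A (fst g). \<forall>ys \<in> tuples A (fst g).
        list_all2 (\<lambda>x y. (x, y) \<in> \<rho>) xs ys \<longrightarrow> (snd g xs, snd g ys) \<in> \<rho>)"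

definition stable :: "'a set \<Rightarrow> 'a operation set \<Rightarrow> ('a \<times> 'a) set \<Rightarrow> bool" where
  "stable A \<Xi> \<rho> \<longleftrightarrow> (\<forall>\<xi> \<in> \<Xi>. compatible A \<rho> \<xi>)"

definition congruence :: "'a set \<Rightarrow> 'a operation set \<Rightarrow> ('a \<times> 'a) set \<Rightarrow> bool" where
  "congruence A \<Xi> \<rho> \<longleftrightarrow> equiv A \<rho> \<and> stable A \<Xi> \<rho>"

definition stable_preorder :: "'a set \<Rightarrow> 'a operation set \<Rightarrow> ('a \<times> 'a) set \<Rightarrow> bool" where
  "stable_preorder A \<Xi> \<rho> \<longleftrightarrow> preorder_on A \<rho> \<and> stable A \<Xi> \<rho>"

definition finite_index_congruence :: "'a set \<Rightarrow> 'a operation set \<Rightarrow> ('a \<times> 'a) set \<Rightarrow> bool" where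
  "finite_index_congruence A \<Xi> \<rho> \<longleftrightarrow> congruence A \<Xi> \<rho> \<and> finite (A // \<rho>)"

definition finite_index_stable_preorder ::
    "'a set \<Rightarrow> 'a operation set \<Rightarrow> ('a \<times> 'a) set \<Rightarrow> bool" where
  "finite_index_stable_preorder A \<Xi> \<rho> \<longleftrightarrow> stable_preorder A \<Xi> \<rho> \<and> finite (A // (\<rho> \<inter> \<rho>\<inverse>))"

definition congruence_preserving :: "'a set \<Rightarrow> 'a operation set \<Rightarrow> ('a \<Rightarrow> 'a) \<Rightarrow> bool" where
  "congruence_preserving A \<Xi> f \<longleftrightarrow>
     (\<forall>\<rho>. congruence A \<Xi> \<rho> \<longrightarrow> compatible A \<rho> (unary_op f))"

definition stable_preorder_preserving :: "'a set \<Rightarrow> 'a operation set \<Rightarrow> ('a \<Rightarrow> 'a) \<Rightarrow> bool" where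
  "stable_preorder_preserving A \<Xi> f \<longleftrightarrow>
     (\<forall>\<rho>. stable_preorder A \<Xi> \<rho> \<longrightarrow> compatible A \<rho> (unary_op f))"

definition finite_index_congruence_preserving ::
    "'a set \<Rightarrow> 'a operation set \<Rightarrow> ('a \<Rightarrow> 'a) \<Rightarrow> bool" where
  "finite_index_congruence_preserving A \<Xi> f \<longleftrightarrow>
     (\<forall>\<rho>. finite_index_congruence A \<Xi> \<rho> \<longrightarrow> compatible A \<rho> (unary_op f))"

definition finite_index_stable_preorder_preserving ::
    "'a set \<Rightarrow> 'a operation set \<Rightarrow> ('a \<Rightarrow> 'a) \<Rightarrow> bool" where
  "finite_index_stable_preorder_preserving A \<Xi> f \<longleftrightarrow>
     (\<forall>\<rho>. finite_index_stable_preorder A \<Xi> \<rho> \<longrightarrow> compatible A \<rho> (unary_op f))"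

definition recognizable :: "'a set \<Rightarrow> 'a operation set \<Rightarrow> 'a set \<Rightarrow> bool" where
  "recognizable A \<Xi> L \<longleftrightarrow>
     (\<exists>\<rho>. finite_index_congruence A \<Xi> \<rho> \<and> (\<exists>C \<subseteq> A // \<rho>. L = \<Union>C))"

text \<open>
  In the freezification at position \<open>i\<close> the entry \<open>cs ! i\<close> is overwritten, so only the other
  entries of \<open>cs\<close> act as constants. A nullary operation has no freezification.
\<close>

definition freezifications :: "'a set \<Rightarrow> 'a operation set \<Rightarrow> ('a \<Rightarrow> 'a) set" where
  "freezifications A \<Xi> =
     {\<lambda>x. \<xi> (cs[i := x]) | n \<xi> cs i. (n, \<xi>) \<in> \<Xi> \<and> n \<ge> 2 \<and> i < n \<and> cs \<in> tuples A n}
     \<union> {\<lambda>x. \<xi> [x] | \<xi>. (1, \<xi>) \<in> \<Xi>}"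

definition freez_star :: "'a set \<Rightarrow> 'a operation set \<Rightarrow> ('a \<Rightarrow> 'a) set" where
  "freez_star A \<Xi> = {foldr (\<circ>) \<phi>s id | \<phi>s. set \<phi>s \<subseteq> freezifications A \<Xi>}"

definition preimage :: "'a set \<Rightarrow> ('a \<Rightarrow> 'a) \<Rightarrow> 'a set \<Rightarrow> 'a set" where
  "preimage A f X = f -` X \<inter> A"

text \<open>
  Intersections and complements are relative to \<open>A\<close>; in particular the empty intersection is \<open>A\<close>.
\<close>

inductive_set latt_fin :: "'a set \<Rightarrow> 'a operation set \<Rightarrow> 'a set \<Rightarrow> 'a set set"
  for A :: "'a set" and \<Xi> :: "'a operation set" and L :: "'a set" where
  base: "L \<in> latt_fin A \<Xi> L"
| empty: "{} \<in> latt_fin A \<Xi> L"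
| carrier: "A \<in> latt_fin A \<Xi> L"
| union: "X \<in> latt_fin A \<Xi> L \<Longrightarrow> Y \<in> latt_fin A \<Xi> L \<Longrightarrow> X \<union> Y \<in> latt_fin A \<Xi> L"
| inter: "X \<in> latt_fin A \<Xi> L \<Longrightarrow> Y \<in> latt_fin A \<Xi> L \<Longrightarrow> X \<inter> Y \<in> latt_fin A \<Xi> L"
| preimage: "X \<in> latt_fin A \<Xi> L \<Longrightarrow> \<gamma> \<in> freez_star A \<Xi> \<Longrightarrow> preimage A \<gamma> X \<in> latt_fin A \<Xi> L"

inductive_set latt_inf :: "'a set \<Rightarrow> 'a operation set \<Rightarrow> 'a set \<Rightarrow> 'a set set"
  for A :: "'a set" and \<Xi> :: "'a operation set" and L :: "'a set" where
  base: "L \<in> latt_inf A \<Xi> L"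
| Union: "(\<And>X. X \<in> F \<Longrightarrow> X \<in> latt_inf A \<Xi> L) \<Longrightarrow> \<Union>F \<in> latt_inf A \<Xi> L"
| Inter: "(\<And>X. X \<in> F \<Longrightarrow> X \<in> latt_inf A \<Xi> L) \<Longrightarrow> A \<inter> \<Inter>F \<in> latt_inf A \<Xi> L"
| preimage: "X \<in> latt_inf A \<Xi> L \<Longrightarrow> \<gamma> \<in> freez_star A \<Xi> \<Longrightarrow> preimage A \<gamma> X \<in> latt_inf A \<Xi> L"

inductive_set bool_fin :: "'a set \<Rightarrow> 'a operation set \<Rightarrow> 'a set \<Rightarrow> 'a set set"
  for A :: "'a set" and \<Xi> :: "'a operation set" and L :: "'a set" where
  base: "L \<in> bool_fin A \<Xi> L"
| empty: "{} \<in> bool_fin A \<Xi> L"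
| carrier: "A \<in> bool_fin A \<Xi> L"
| union: "X \<in> bool_fin A \<Xi> L \<Longrightarrow> Y \<in> bool_fin A \<Xi> L \<Longrightarrow> X \<union> Y \<in> bool_fin A \<Xi> L"
| inter: "X \<in> bool_fin A \<Xi> L \<Longrightarrow> Y \<in> bool_fin A \<Xi> L \<Longrightarrow> X \<inter> Y \<in> bool_fin A \<Xi> L"
| compl: "X \<in> bool_fin A \<Xi> L \<Longrightarrow> A - X \<in> bool_fin A \<Xi> L"
| preimage: "X \<in> bool_fin A \<Xi> L \<Longrightarrow> \<gamma> \<in> freez_star A \<Xi> \<Longrightarrow> preimage A \<gamma> X \<in> bool_fin A \<Xi> L"

inductive_set bool_inf :: "'a set \<Rightarrow> 'a operation set \<Rightarrow> 'a set \<Rightarrow> 'a set set"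
  for A :: "'a set" and \<Xi> :: "'a operation set" and L :: "'a set" where
  base: "L \<in> bool_inf A \<Xi> L"
| Union: "(\<And>X. X \<in> F \<Longrightarrow> X \<in> bool_inf A \<Xi> L) \<Longrightarrow> \<Union>F \<in> bool_inf A \<Xi> L"
| Inter: "(\<And>X. X \<in> F \<Longrightarrow> X \<in> bool_inf A \<Xi> L) \<Longrightarrow> A \<inter> \<Inter>F \<in> bool_inf A \<Xi> L"
| compl: "X \<in> bool_inf A \<Xi> L \<Longrightarrow> A - X \<in> bool_inf A \<Xi> L"
| preimage: "X \<in> bool_inf A \<Xi> L \<Longrightarrow> \<gamma> \<in> freez_star A \<Xi> \<Longrightarrow> preimage A \<gamma> X \<in> bool_inf A \<Xi> L"

end

theory Submission
  imports Defs
begin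

text \<open>
  Each of the four families \<open>T\<close> generated by \<open>L\<close> is closed under preimages by freezifications, so
  ``every member of \<open>T\<close> containing \<open>x\<close> contains \<open>y\<close>'' is a stable preorder, and a congruence if
  \<open>T\<close> is closed under complementation. If \<open>f\<close> preserves it, then the preimage of \<open>L\<close> is the union,
  over its points \<open>a\<close>, of the intersections of all members of \<open>T\<close> containing \<open>a\<close>. For recognizable
  \<open>L\<close> the members of \<open>T\<close> are unions of classes of a single finite index congruence, so \<open>T\<close> is
  finite and the unions and intersections are finite.

  Conversely, for a stable preorder \<open>\<rho>\<close> with \<open>(x, y) \<in> \<rho>\<close>, take for \<open>L\<close> the up-set generated by
  \<open>f x\<close>: all members of the family generated by \<open>L\<close> are up-sets of \<open>\<rho>\<close>, so the preimage of \<open>L\<close>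
  contains \<open>y\<close> along with \<open>x\<close>.
\<close>

subsection \<open>Stability and freezifications\<close>

lemma compatible_unary_op_iff:
  assumes "\<rho> \<subseteq> A \<times> A"
  shows "compatible A \<rho> (unary_op f) \<longleftrightarrow> (\<forall>(x, y) \<in> \<rho>. (f x, f y) \<in> \<rho>)"
proof
  assume c: "compatible A \<rho> (unary_op f)"
  show "\<forall>(x, y) \<in> \<rho>. (f x, f y) \<in> \<rho>"
  proof clarify
    fix x y assume "(x, y) \<in> \<rho>"
    moreover from this assms have "[x] \<in> tuples A 1" "[y] \<in> tuples A 1"
      by (auto simp: tuples_def)
    ultimately show "(f x, f y) \<in> \<rho>"
      using c by (fastforce simp: compatible_def unary_op_def)
  qed
next
  assume "\<forall>(x, y) \<in> \<rho>. (f x, f y) \<in> \<rho>"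
  then show "compatible A \<rho> (unary_op f)"
    by (auto simp: compatible_def unary_op_def tuples_def length_Suc_conv)
qed

context univ_algebra
begin

lemma freezification_closed:
  assumes "\<phi> \<in> freezifications A \<Xi>" and "x \<in> A"
  shows "\<phi> x \<in> A"
proof -
  have "cs[i := x] \<in> tuples A n" if "cs \<in> tuples A n" for cs i n
    using that assms(2) set_update_subset_insert[of cs i x] by (auto simp: tuples_def)
  moreover have "[x] \<in> tuples A 1"
    using assms(2) by (simp add: tuples_def)
  ultimately show ?thesis
    using assms(1) closed by (fastforce simp: freezifications_def Pi_iff)
qed

text \<open>Away from position \<open>i\<close> the two argument lists share their constants, which
  are related by reflexivity; compatibility with \<open>\<xi>\<close> then applies.\<close>

lemma stable_freezification:
  assumes "stable A \<Xi> \<rho>" and refl: "refl_on A \<rho>" and sub: "\<rho> \<subseteq> A \<times> A"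
    and "\<phi> \<in> freezifications A \<Xi>" and xy: "(x, y) \<in> \<rho>"
  shows "(\<phi> x, \<phi> y) \<in> \<rho>"
proof -
  have compat: "(\<xi> xs, \<xi> ys) \<in> \<rho>"
    if "(n, \<xi>) \<in> \<Xi>" "xs \<in> tuples A n" "ys \<in> tuples A n" "list_all2 (\<lambda>x y. (x, y) \<in> \<rho>) xs ys"
    for n \<xi> xs ys
    using assms(1) that by (fastforce simp: stable_def compatible_def)
  have A: "x \<in> A" "y \<in> A" using xy sub by auto
  from assms(4) consider (nary) n \<xi> cs i where "\<phi> = (\<lambda>x. \<xi> (cs[i := x]))" "(n, \<xi>) \<in> \<Xi>"
      "cs \<in> tuples A n" | (unary) \<xi> where "\<phi> = (\<lambda>x. \<xi> [x])" "(1, \<xi>) \<in> \<Xi>"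
    by (auto simp: freezifications_def)
  then show ?thesis
  proof cases
    case nary
    have "cs[i := z] \<in> tuples A n" if "z \<in> A" for z
      using that nary(3) set_update_subset_insert[of cs i z] by (auto simp: tuples_def)
    \<comment> \<open>The bound on \<open>i\<close> was not kept in the case distinction; for
      \<open>i\<close> out of range both updates leave \<open>cs\<close> unchanged.\<close>
    moreover have "list_all2 (\<lambda>x y. (x, y) \<in> \<rho>) (cs[i := x]) (cs[i := y])"
      using nary(3) xy refl
      by (cases "i < length cs")
        (auto simp: list_all2_conv_all_nth nth_list_update tuples_def refl_on_def subset_iff)
    ultimately show ?thesis using compat[OF nary(2)] A nary(1) by simp
  next
    case unary
    then show ?thesis using compat[OF unary(2), of "[x]" "[y]"] A xy by (simp add: tuples_def)
  qed
qed

text \<open>The \<open>foldr\<close> in \<open>freez_star\<close> puts the first list entry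
  outermost, so induction on the list peels off the freezification applied last.\<close>

lemma freez_star_induct [consumes 1, case_names id comp]:
  assumes "\<gamma> \<in> freez_star A \<Xi>"
    and "P id" and "\<And>\<phi> \<gamma>. \<phi> \<in> freezifications A \<Xi> \<Longrightarrow> P \<gamma> \<Longrightarrow> P (\<phi> \<circ> \<gamma>)"
  shows "P \<gamma>"
proof -
  obtain \<phi>s where "set \<phi>s \<subseteq> freezifications A \<Xi>" and "\<gamma> = foldr (\<circ>) \<phi>s id"
    using assms(1) by (auto simp: freez_star_def)
  then show ?thesis
    using assms(2,3) by (induction \<phi>s arbitrary: \<gamma>) auto
qed

lemma freezification_in_freez_star: "\<phi> \<in> freezifications A \<Xi> \<Longrightarrow> \<phi> \<in> freez_star A \<Xi>"
  unfolding freez_star_def by (intro CollectI exI[of _ "[\<phi>]"]) auto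

lemma stable_freez_star:
  assumes "stable A \<Xi> \<rho>" "refl_on A \<rho>" "\<rho> \<subseteq> A \<times> A" "\<gamma> \<in> freez_star A \<Xi>" "(x, y) \<in> \<rho>"
  shows "(\<gamma> x, \<gamma> y) \<in> \<rho>"
  using assms(4) by (induction rule: freez_star_induct)
    (use assms stable_freezification in auto)

text \<open>The arguments of an operation are replaced one at a time, and transitivity does the rest.\<close>

lemma stableI_freezifications:
  assumes pre: "preorder_on A \<rho>"
    and mono: "\<And>\<phi> x y. \<phi> \<in> freezifications A \<Xi> \<Longrightarrow> (x, y) \<in> \<rho> \<Longrightarrow> (\<phi> x, \<phi> y) \<in> \<rho>"
  shows "stable A \<Xi> \<rho>"
  unfolding stable_def compatible_def
proof clarsimp
  fix n \<xi> xs ys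
  assume op: "(n, \<xi>) \<in> \<Xi>" and xs: "xs \<in> tuples A n" and ys: "ys \<in> tuples A n"
    and all: "list_all2 (\<lambda>x y. (x, y) \<in> \<rho>) xs ys"
  have len: "length xs = n" "length ys = n" and sets: "set xs \<subseteq> A" "set ys \<subseteq> A"
    using xs ys by (auto simp: tuples_def)
  have refl: "(\<xi> xs, \<xi> xs) \<in> \<rho>"
    using pre closed[OF op] xs by (auto simp: preorder_on_def refl_on_def)
  consider "n = 0" | "n = 1" | "n \<ge> 2" by linarith
  then show "(\<xi> xs, \<xi> ys) \<in> \<rho>"
  proof cases
    case 1
    \<comment> \<open>A nullary operation has no freezification, but both argument lists are empty,
      so reflexivity suffices.\<close>
    then show ?thesis using refl len by simp
  next
    case 2
    then obtain x y where xy: "xs = [x]" "ys = [y]"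
      using len by (auto simp: length_Suc_conv)
    moreover have "(\<lambda>x. \<xi> [x]) \<in> freezifications A \<Xi>"
      using op 2 by (auto simp: freezifications_def)
    ultimately show ?thesis using mono all by fastforce
  next
    case 3
    \<comment> \<open>The hybrid list has its first \<open>k\<close> entries from \<open>ys\<close>
      and the others from \<open>xs\<close>; it runs from \<open>xs\<close> at \<open>k = 0\<close>
      to \<open>ys\<close> at \<open>k = n\<close>.\<close>
    have "k \<le> n \<Longrightarrow> (\<xi> xs, \<xi> (take k ys @ drop k xs)) \<in> \<rho>" for k
    proof (induction k)
      case 0
      then show ?case using refl by simp
    next
      case (Suc k)
      define zs where "zs = take k ys @ drop k xs"
      have k: "k < n" using Suc by simp
      have zs: "zs \<in> tuples A n"
        using sets len k set_take_subset[of k ys] set_drop_subset[of k xs]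
        by (auto simp: zs_def tuples_def)
      have "(\<lambda>x. \<xi> (zs[k := x])) \<in> freezifications A \<Xi>"
        using op 3 k zs by (auto simp: freezifications_def)
      then have "(\<xi> (zs[k := xs ! k]), \<xi> (zs[k := ys ! k])) \<in> \<rho>"
        using mono[of "\<lambda>x. \<xi> (zs[k := x])"] all k len by (simp add: list_all2_conv_all_nth)
      \<comment> \<open>Position \<open>k\<close> of the hybrid still carries the entry of
        \<open>xs\<close>, so one freezification at \<open>k\<close> has the current hybrid as one
        value and the next hybrid as the other.\<close>
      moreover have "zs[k := xs ! k] = zs"
        using k len by (intro list_update_same_conv[THEN iffD2]) (auto simp: zs_def nth_append)
      moreover have "zs[k := ys ! k] = take (Suc k) ys @ drop (Suc k) xs"
        using k len by (auto simp: zs_def list_eq_iff_nth_eq nth_list_update nth_append)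
      ultimately show ?case
        using Suc pre unfolding zs_def preorder_on_def by (auto dest: transD)
    qed
    from this[of n] show ?thesis using len by simp
  qed
qed

end

section \<open>Passing between stable preorders and congruences\<close>

lemma stable_preorder_imp_congruence:
  assumes "stable_preorder A \<Xi> \<rho>"
  shows "congruence A \<Xi> (\<rho> \<inter> \<rho>\<inverse>)"
proof -
  have "equiv A (\<rho> \<inter> \<rho>\<inverse>)"
    using assms by (auto simp: stable_preorder_def preorder_on_def equiv_def refl_on_def sym_def
      intro!: transI dest: transD)
  moreover have "stable A \<Xi> (\<rho> \<inter> \<rho>\<inverse>)"
    unfolding stable_def compatible_def
  proof (intro ballI impI)
    fix g xs ys
    assume g: "g \<in> \<Xi>" and t: "xs \<in> tuples A (fst g)" "ys \<in> tuples A (fst g)"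
      and all: "list_all2 (\<lambda>x y. (x, y) \<in> \<rho> \<inter> \<rho>\<inverse>) xs ys"
    \<comment> \<open>Stability of \<open>\<rho>\<close> is used in both directions, from
      \<open>xs\<close> to \<open>ys\<close> and back.\<close>
    have "list_all2 (\<lambda>x y. (x, y) \<in> \<rho>) xs ys" "list_all2 (\<lambda>x y. (x, y) \<in> \<rho>) ys xs"
      using all by (auto simp: list_all2_conv_all_nth)
    then show "(snd g xs, snd g ys) \<in> \<rho> \<inter> \<rho>\<inverse>"
      using assms g t by (auto simp: stable_preorder_def stable_def compatible_def)
  qed
  ultimately show ?thesis by (simp add: congruence_def)
qed

lemma congruence_imp_stable_preorder: "congruence A \<Xi> \<rho> \<Longrightarrow> stable_preorder A \<Xi> \<rho>"
  by (auto simp: congruence_def stable_preorder_def preorder_on_def equiv_def)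

text \<open>A symmetric relation equals its intersection with its converse, so the two notions of
  index agree.\<close>

lemma finite_index_congruence_imp_stable_preorder:
  assumes "finite_index_congruence A \<Xi> \<rho>"
  shows "finite_index_stable_preorder A \<Xi> \<rho>"
proof -
  have "\<rho>\<inverse> = \<rho>"
    using assms by (simp add: finite_index_congruence_def congruence_def equiv_def sym_conv_converse_eq)
  then show ?thesis
    using assms congruence_imp_stable_preorder
    by (auto simp: finite_index_congruence_def finite_index_stable_preorder_def)
qed

subsection \<open>Up-sets\<close>

text \<open>For an equivalence these are the unions of classes, so that one notion serves preorders
  and congruences alike.\<close>

definition upsets :: "'a set \<Rightarrow> ('a \<times> 'a) set \<Rightarrow> 'a set set" where
  "upsets A \<rho> = {X. X \<subseteq> A \<and> \<rho> `` X \<subseteq> X}"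

lemma upsets_Union:
  assumes "\<And>X. X \<in> F \<Longrightarrow> X \<in> upsets A \<rho>"
  shows "\<Union>F \<in> upsets A \<rho>"
  using assms unfolding upsets_def by blast

lemma upsets_Inter:
  assumes "\<rho> \<subseteq> A \<times> A" and "\<And>X. X \<in> F \<Longrightarrow> X \<in> upsets A \<rho>"
  shows "A \<inter> \<Inter>F \<in> upsets A \<rho>"
  using assms unfolding upsets_def by blast

text \<open>By symmetry an up-set is closed downwards as well, so no point outside it is related to
  a point inside.\<close>

lemma upsets_compl: "sym \<rho> \<Longrightarrow> \<rho> \<subseteq> A \<times> A \<Longrightarrow> X \<in> upsets A \<rho> \<Longrightarrow> A - X \<in> upsets A \<rho>"
  unfolding upsets_def sym_def by blast

lemma upsets_Image_singleton:
  assumes "preorder_on A \<rho>"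
  shows "\<rho> `` {x} \<in> upsets A \<rho>"
  using assms by (auto simp: upsets_def preorder_on_def dest: transD)

text \<open>A closed set is the union of the classes of its own points; conversely, a class contains
  everything related to one of its members.\<close>

lemma upsets_equiv_iff:
  assumes "equiv A \<theta>"
  shows "X \<in> upsets A \<theta> \<longleftrightarrow> (\<exists>C \<subseteq> A // \<theta>. X = \<Union>C)"
proof
  assume "X \<in> upsets A \<theta>"
  then have "X \<subseteq> A" "\<theta> `` X \<subseteq> X" by (auto simp: upsets_def)
  moreover from this have "X = \<Union>((\<lambda>x. \<theta> `` {x}) ` X)"
    using equiv_class_self[OF assms] by fastforce
  ultimately show "\<exists>C \<subseteq> A // \<theta>. X = \<Union>C"
    by (intro exI[of _ "(\<lambda>x. \<theta> `` {x}) ` X"]) (auto simp: quotient_def)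
next
  assume "\<exists>C \<subseteq> A // \<theta>. X = \<Union>C"
  then obtain C where "C \<subseteq> A // \<theta>" "X = \<Union>C" by blast
  then show "X \<in> upsets A \<theta>"
    using assms in_quotient_imp_subset[OF assms] in_quotient_imp_closed[OF assms]
    by (fastforce simp: upsets_def)
qed

text \<open>An up-set of an equivalence is determined by the set of classes whose union it is, and
  there are finitely many such sets of classes.\<close>

lemma finite_upsets:
  assumes "equiv A \<theta>" and "finite (A // \<theta>)"
  shows "finite (upsets A \<theta>)"
proof (rule finite_subset)
  show "upsets A \<theta> \<subseteq> Union ` Pow (A // \<theta>)"
    using upsets_equiv_iff[OF assms(1)] by blast
qed (use assms(2) in simp)

section \<open>Recognizable sets as up-sets of finite index congruences\<close>

lemma recognizable_iff:
  "recognizable A \<Xi> L \<longleftrightarrow> (\<exists>\<theta>. finite_index_congruence A \<Xi> \<theta> \<and> L \<in> upsets A \<theta>)"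
  unfolding recognizable_def finite_index_congruence_def congruence_def
  by (metis upsets_equiv_iff)

text \<open>An up-set of \<open>\<rho>\<close> is also one of the smaller relation
  \<open>\<rho> \<inter> \<rho>\<inverse>\<close>, which is a finite index congruence. This makes
  principal up-sets admissible test sets in the finite index equivalences.\<close>

lemma recognizable_Image_singleton:
  assumes "finite_index_stable_preorder A \<Xi> \<rho>"
  shows "recognizable A \<Xi> (\<rho> `` {x})"
proof -
  have "finite_index_congruence A \<Xi> (\<rho> \<inter> \<rho>\<inverse>)"
    using assms stable_preorder_imp_congruence
    by (auto simp: finite_index_stable_preorder_def finite_index_congruence_def)
  moreover have "\<rho> `` {x} \<in> upsets A (\<rho> \<inter> \<rho>\<inverse>)"
    using assms upsets_Image_singleton[of A \<rho> x]
    by (auto simp: finite_index_stable_preorder_def stable_preorder_def upsets_def)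
  ultimately show ?thesis by (auto simp: recognizable_iff)
qed

section \<open>The generated families consist of up-sets\<close>

context univ_algebra
begin

text \<open>Stability makes \<open>\<gamma>\<close> monotone for \<open>\<rho>\<close>, and the
  preimage of an up-set under a monotone map is an up-set.\<close>

lemma upsets_preimage:
  assumes "stable_preorder A \<Xi> \<rho>" and "X \<in> upsets A \<rho>" and "\<gamma> \<in> freez_star A \<Xi>"
  shows "preimage A \<gamma> X \<in> upsets A \<rho>"
proof -
  have "(\<gamma> x, \<gamma> y) \<in> \<rho>" if "(x, y) \<in> \<rho>" for x y
    using stable_freez_star assms(1,3) that by (auto simp: stable_preorder_def preorder_on_def)
  moreover have "\<rho> \<subseteq> A \<times> A"
    using assms(1) by (auto simp: stable_preorder_def preorder_on_def)
  ultimately show ?thesis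
    using assms(2) by (fastforce simp: upsets_def preimage_def)
qed

text \<open>The up-sets of a stable preorder include \<open>L\<close> and are closed under every
  generating operation, so they include the smallest such family. The same argument serves the other
  three families.\<close>

lemma latt_inf_subset_upsets:
  assumes "stable_preorder A \<Xi> \<rho>" and "L \<in> upsets A \<rho>"
  shows "latt_inf A \<Xi> L \<subseteq> upsets A \<rho>"
proof
  have sub: "\<rho> \<subseteq> A \<times> A"
    using assms(1) by (auto simp: stable_preorder_def preorder_on_def)
  fix X assume "X \<in> latt_inf A \<Xi> L"
  then show "X \<in> upsets A \<rho>"
  proof induction
    case Union
    then show ?case using upsets_Union by blast
  next
    case Inter
    then show ?case using upsets_Inter[OF sub] by blast
  next
    case preimage
    then show ?case using upsets_preimage assms(1) by blast
  qed (use assms(2) sub in \<open>auto simp: upsets_def\<close>)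
qed

lemma latt_fin_subset_upsets:
  assumes "stable_preorder A \<Xi> \<rho>" and "L \<in> upsets A \<rho>"
  shows "latt_fin A \<Xi> L \<subseteq> upsets A \<rho>"
proof
  have sub: "\<rho> \<subseteq> A \<times> A"
    using assms(1) by (auto simp: stable_preorder_def preorder_on_def)
  fix X assume "X \<in> latt_fin A \<Xi> L"
  then show "X \<in> upsets A \<rho>"
  proof induction
    case preimage
    then show ?case using upsets_preimage assms(1) by blast
  qed (use assms(2) sub in \<open>auto simp: upsets_def\<close>)
qed

lemma bool_inf_subset_upsets:
  assumes "congruence A \<Xi> \<rho>" and "L \<in> upsets A \<rho>"
  shows "bool_inf A \<Xi> L \<subseteq> upsets A \<rho>"
proof
  have sub: "\<rho> \<subseteq> A \<times> A" and sym: "sym \<rho>"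
    using assms(1) by (auto simp: congruence_def equiv_def)
  fix X assume "X \<in> bool_inf A \<Xi> L"
  then show "X \<in> upsets A \<rho>"
  proof induction
    case Union
    then show ?case using upsets_Union by blast
  next
    case Inter
    then show ?case using upsets_Inter[OF sub] by blast
  next
    \<comment> \<open>Complementation is the one operation that calls for symmetry, hence for a
      congruence in place of a stable preorder.\<close>
    case compl
    then show ?case using upsets_compl sym sub by blast
  next
    case preimage
    then show ?case using upsets_preimage congruence_imp_stable_preorder assms(1) by blast
  qed (use assms(2) sub in \<open>auto simp: upsets_def\<close>)
qed

lemma bool_fin_subset_upsets:
  assumes "congruence A \<Xi> \<rho>" and "L \<in> upsets A \<rho>"
  shows "bool_fin A \<Xi> L \<subseteq> upsets A \<rho>"
proof
  have sub: "\<rho> \<subseteq> A \<times> A" and sym: "sym \<rho>"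
    using assms(1) by (auto simp: congruence_def equiv_def)
  fix X assume "X \<in> bool_fin A \<Xi> L"
  then show "X \<in> upsets A \<rho>"
  proof induction
    case compl
    then show ?case using upsets_compl sym sub by blast
  next
    case preimage
    then show ?case using upsets_preimage congruence_imp_stable_preorder assms(1) by blast
  qed (use assms(2) sub in \<open>auto simp: upsets_def\<close>)
qed

end

text \<open>It suffices to test principal up-sets: \<open>x\<close> lies in the preimage of the
  up-set of \<open>f x\<close> by reflexivity, so any \<open>y\<close> above \<open>x\<close> lies
  there too, which says that \<open>f y\<close> is above \<open>f x\<close>.\<close>

lemma compatible_unary_opI_upsets:
  assumes pre: "preorder_on A \<rho>" and f: "f \<in> A \<rightarrow> A"
    and up: "\<And>x. x \<in> A \<Longrightarrow> preimage A f (\<rho> `` {f x}) \<in> upsets A \<rho>"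
  shows "compatible A \<rho> (unary_op f)"
proof -
  have sub: "\<rho> \<subseteq> A \<times> A" and refl: "refl_on A \<rho>"
    using pre by (auto simp: preorder_on_def)
  have "(f x, f y) \<in> \<rho>" if xy: "(x, y) \<in> \<rho>" for x y
  proof -
    have x: "x \<in> A" using xy sub by auto
    then have "x \<in> preimage A f (\<rho> `` {f x})"
      using f refl by (auto simp: preimage_def refl_on_def)
    then have "y \<in> preimage A f (\<rho> `` {f x})"
      using up[OF x] xy by (auto simp: upsets_def)
    then show ?thesis by (simp add: preimage_def)
  qed
  then show ?thesis using compatible_unary_op_iff[OF sub] by blast
qed

subsection \<open>The preorder induced by a family of sets\<close>

text \<open>This is the specialization preorder known from topology, with \<open>T\<close> in the
  role of the open sets.\<close>

definition induced_preorder :: "'a set \<Rightarrow> 'a set set \<Rightarrow> ('a \<times> 'a) set" where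
  "induced_preorder A T = {(x, y) \<in> A \<times> A. \<forall>X \<in> T. x \<in> X \<longrightarrow> y \<in> X}"

lemma preorder_on_induced_preorder: "preorder_on A (induced_preorder A T)"
  by (auto simp: preorder_on_def induced_preorder_def refl_on_def intro!: transI)

text \<open>If a member \<open>X\<close> contained \<open>y\<close> but not \<open>x\<close>, then
  its complement would be a member containing \<open>x\<close> but not \<open>y\<close>.\<close>

lemma sym_induced_preorder:
  "(\<And>X. X \<in> T \<Longrightarrow> A - X \<in> T) \<Longrightarrow> sym (induced_preorder A T)"
  unfolding induced_preorder_def by (rule symI) blast

text \<open>Points related by \<open>\<theta>\<close> lie in the same members of \<open>T\<close>,
  so \<open>\<theta>\<close> refines the equivalence of the induced preorder; a coarser equivalence
  has no more classes.\<close>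

lemma finite_index_induced_preorder:
  assumes "equiv A \<theta>" and "finite (A // \<theta>)" and "T \<subseteq> upsets A \<theta>"
  shows "finite (A // (induced_preorder A T \<inter> (induced_preorder A T)\<inverse>))" (is "finite (A // ?S)")
proof (rule finite_refines_finite[OF assms(2) _ assms(1)])
  have "\<theta> \<subseteq> A \<times> A" "sym \<theta>" using assms(1) by (auto simp: equiv_def)
  then show "\<theta> \<subseteq> ?S"
    using assms(3) unfolding induced_preorder_def upsets_def sym_def by blast
  show "equiv A ?S"
    by (auto simp: equiv_def induced_preorder_def refl_on_def sym_def intro!: transI)
qed

text \<open>If \<open>X\<close> in \<open>T\<close> contains \<open>\<phi> x\<close>, its preimage
  under \<open>\<phi>\<close> is a member of \<open>T\<close> containing \<open>x\<close>, hence
  \<open>y\<close>; so \<open>X\<close> contains \<open>\<phi> y\<close>. Monotonicity under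
  freezifications is enough for stability.\<close>

lemma (in univ_algebra) stable_preorder_induced_preorder:
  assumes "\<And>X \<gamma>. X \<in> T \<Longrightarrow> \<gamma> \<in> freez_star A \<Xi> \<Longrightarrow> preimage A \<gamma> X \<in> T"
  shows "stable_preorder A \<Xi> (induced_preorder A T)"
proof -
  have "(\<phi> x, \<phi> y) \<in> induced_preorder A T"
    if \<phi>: "\<phi> \<in> freezifications A \<Xi>" and xy: "(x, y) \<in> induced_preorder A T" for \<phi> x y
  proof -
    have "\<phi> y \<in> X" if "X \<in> T" "\<phi> x \<in> X" for X
    proof -
      have "preimage A \<phi> X \<in> T"
        using assms that(1) freezification_in_freez_star[OF \<phi>] by blast
      then show ?thesis using xy that(2) by (auto simp: induced_preorder_def preimage_def)
    qed
    then show ?thesis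
      using xy freezification_closed[OF \<phi>] by (auto simp: induced_preorder_def)
  qed
  then show ?thesis
    unfolding stable_preorder_def
    by (intro conjI stableI_freezifications preorder_on_induced_preorder)
qed

lemma (in univ_algebra) congruence_induced_preorder:
  assumes "\<And>X \<gamma>. X \<in> T \<Longrightarrow> \<gamma> \<in> freez_star A \<Xi> \<Longrightarrow> preimage A \<gamma> X \<in> T"
    and "\<And>X. X \<in> T \<Longrightarrow> A - X \<in> T"
  shows "congruence A \<Xi> (induced_preorder A T)"
proof -
  have "stable_preorder A \<Xi> (induced_preorder A T)"
    using stable_preorder_induced_preorder assms(1) by blast
  with sym_induced_preorder[of T A] assms(2) show ?thesis
    by (auto simp: congruence_def stable_preorder_def preorder_on_def equiv_def)
qed

text \<open>The intersection formed for \<open>a\<close> is the principal up-set of \<open>a\<close>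
  in the induced preorder. As \<open>L\<close> is in \<open>T\<close> and \<open>f\<close> is
  monotone, the preimage is an up-set, hence the union of the principal up-sets of its
  points.\<close>

lemma preimage_eq_Union_Inter:
  assumes f: "f \<in> A \<rightarrow> A" and L: "L \<in> T"
    and compat: "compatible A (induced_preorder A T) (unary_op f)"
  shows "preimage A f L = \<Union>((\<lambda>a. A \<inter> \<Inter>{X \<in> T. a \<in> X}) ` preimage A f L)"
proof
  have "y \<in> preimage A f L"
    if "a \<in> preimage A f L" "y \<in> A" "\<forall>X \<in> T. a \<in> X \<longrightarrow> y \<in> X" for a y
  proof -
    have "(a, y) \<in> induced_preorder A T"
      using that by (auto simp: induced_preorder_def preimage_def)
    moreover have "induced_preorder A T \<subseteq> A \<times> A"
      by (auto simp: induced_preorder_def)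
    ultimately have "(f a, f y) \<in> induced_preorder A T"
      using compat compatible_unary_op_iff by blast
    then show ?thesis using that L by (auto simp: induced_preorder_def preimage_def)
  qed
  then show "\<Union>((\<lambda>a. A \<inter> \<Inter>{X \<in> T. a \<in> X}) ` preimage A f L) \<subseteq> preimage A f L"
    by blast
qed (auto simp: preimage_def)

lemma preimage_in_complete_family:
  assumes "f \<in> A \<rightarrow> A" "L \<in> T" "compatible A (induced_preorder A T) (unary_op f)"
    and Union: "\<And>F. F \<subseteq> T \<Longrightarrow> \<Union>F \<in> T" and Inter: "\<And>F. F \<subseteq> T \<Longrightarrow> A \<inter> \<Inter>F \<in> T"
  shows "preimage A f L \<in> T"
  by (subst preimage_eq_Union_Inter[OF assms(1-3)], rule Union) (blast intro: Inter)

text \<open>Every subfamily of a finite family is finite, so closure under binary operations, with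
  \<open>{}\<close> and \<open>A\<close> for the empty union and intersection, yields the closure of
  the complete case.\<close>

lemma preimage_in_finite_family:
  assumes "f \<in> A \<rightarrow> A" "L \<in> T" "compatible A (induced_preorder A T) (unary_op f)"
    and "finite T" "{} \<in> T" "A \<in> T"
    and union: "\<And>X Y. X \<in> T \<Longrightarrow> Y \<in> T \<Longrightarrow> X \<union> Y \<in> T"
    and inter: "\<And>X Y. X \<in> T \<Longrightarrow> Y \<in> T \<Longrightarrow> X \<inter> Y \<in> T"
  shows "preimage A f L \<in> T"
proof (rule preimage_in_complete_family[OF assms(1-3)])
  fix F assume F: "F \<subseteq> T"
  then have "finite F" using assms(4) finite_subset by blast
  from this F show "\<Union>F \<in> T"
    by induction (auto intro: union assms)
  from \<open>finite F\<close> F show "A \<inter> \<Inter>F \<in> T"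
  proof induction
    case (insert X F)
    then have "X \<inter> (A \<inter> \<Inter>F) \<in> T" by (auto intro: inter)
    then show ?case by (simp add: Int_left_commute)
  qed (use assms in simp)
qed

subsection \<open>The four equivalences\<close>

context univ_algebra
begin

lemma stable_preorder_preserving_iff:
  assumes f: "f \<in> A \<rightarrow> A"
  shows "stable_preorder_preserving A \<Xi> f \<longleftrightarrow>
    (\<forall>L. L \<subseteq> A \<longrightarrow> preimage A f L \<in> latt_inf A \<Xi> L)"
proof (intro iffI allI impI)
  fix L assume "stable_preorder_preserving A \<Xi> f"
  moreover have "stable_preorder A \<Xi> (induced_preorder A (latt_inf A \<Xi> L))"
    by (intro stable_preorder_induced_preorder latt_inf.preimage)
  ultimately have "compatible A (induced_preorder A (latt_inf A \<Xi> L)) (unary_op f)"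
    by (simp add: stable_preorder_preserving_def)
  then show "preimage A f L \<in> latt_inf A \<Xi> L"
    using preimage_in_complete_family[OF f latt_inf.base] latt_inf.Union latt_inf.Inter
    by (metis subsetD)
next
  assume inf: "\<forall>L. L \<subseteq> A \<longrightarrow> preimage A f L \<in> latt_inf A \<Xi> L"
  show "stable_preorder_preserving A \<Xi> f"
    unfolding stable_preorder_preserving_def
  proof (intro allI impI)
    fix \<rho> assume \<rho>: "stable_preorder A \<Xi> \<rho>"
    then have pre: "preorder_on A \<rho>" by (simp add: stable_preorder_def)
    show "compatible A \<rho> (unary_op f)"
    proof (rule compatible_unary_opI_upsets[OF pre f])
      fix x
      have up: "\<rho> `` {f x} \<in> upsets A \<rho>" using upsets_Image_singleton[OF pre] .
      then have "\<rho> `` {f x} \<subseteq> A" by (simp add: upsets_def)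
      then show "preimage A f (\<rho> `` {f x}) \<in> upsets A \<rho>"
        using inf latt_inf_subset_upsets[OF \<rho> up] by blast
    qed
  qed
qed

text \<open>Recognizability enters twice. In one direction the congruence \<open>\<theta>\<close>
  makes both the family and the index of its induced preorder finite; in the other, the principal
  up-sets used as tests are themselves recognizable.\<close>

lemma finite_index_stable_preorder_preserving_iff:
  assumes f: "f \<in> A \<rightarrow> A"
  shows "finite_index_stable_preorder_preserving A \<Xi> f \<longleftrightarrow>
    (\<forall>L. L \<subseteq> A \<and> recognizable A \<Xi> L \<longrightarrow> preimage A f L \<in> latt_fin A \<Xi> L)"
proof (intro iffI allI impI)
  fix L assume pres: "finite_index_stable_preorder_preserving A \<Xi> f"
    and "L \<subseteq> A \<and> recognizable A \<Xi> L"
  then obtain \<theta> where \<theta>: "congruence A \<Xi> \<theta>" "finite (A // \<theta>)" and L: "L \<in> upsets A \<theta>"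
    by (auto simp: recognizable_iff finite_index_congruence_def)
  let ?T = "latt_fin A \<Xi> L"
  have equiv: "equiv A \<theta>" using \<theta> by (simp add: congruence_def)
  have T: "?T \<subseteq> upsets A \<theta>"
    using latt_fin_subset_upsets[OF congruence_imp_stable_preorder[OF \<theta>(1)] L] .
  have "finite_index_stable_preorder A \<Xi> (induced_preorder A ?T)"
    unfolding finite_index_stable_preorder_def
    by (intro conjI stable_preorder_induced_preorder latt_fin.preimage
        finite_index_induced_preorder[OF equiv \<theta>(2) T])
  then have "compatible A (induced_preorder A ?T) (unary_op f)"
    using pres by (auto simp: finite_index_stable_preorder_preserving_def)
  moreover have "finite ?T"
    using finite_subset[OF T finite_upsets[OF equiv \<theta>(2)]] .
  ultimately show "preimage A f L \<in> ?T"
    by (rule preimage_in_finite_family[OF f latt_fin.base]) (auto intro: latt_fin.intros)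
next
  assume fin: "\<forall>L. L \<subseteq> A \<and> recognizable A \<Xi> L \<longrightarrow> preimage A f L \<in> latt_fin A \<Xi> L"
  show "finite_index_stable_preorder_preserving A \<Xi> f"
    unfolding finite_index_stable_preorder_preserving_def
  proof (intro allI impI)
    fix \<rho> assume \<rho>: "finite_index_stable_preorder A \<Xi> \<rho>"
    then have \<rho>': "stable_preorder A \<Xi> \<rho>" and pre: "preorder_on A \<rho>"
      by (auto simp: finite_index_stable_preorder_def stable_preorder_def)
    show "compatible A \<rho> (unary_op f)"
    proof (rule compatible_unary_opI_upsets[OF pre f])
      fix x
      have up: "\<rho> `` {f x} \<in> upsets A \<rho>" using upsets_Image_singleton[OF pre] .
      then have "\<rho> `` {f x} \<subseteq> A" by (simp add: upsets_def)
      then show "preimage A f (\<rho> `` {f x}) \<in> upsets A \<rho>"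
        using fin recognizable_Image_singleton[OF \<rho>] latt_fin_subset_upsets[OF \<rho>' up]
        by blast
    qed
  qed
qed

lemma congruence_preserving_iff:
  assumes f: "f \<in> A \<rightarrow> A"
  shows "congruence_preserving A \<Xi> f \<longleftrightarrow>
    (\<forall>L. L \<subseteq> A \<longrightarrow> preimage A f L \<in> bool_inf A \<Xi> L)"
proof (intro iffI allI impI)
  fix L assume "congruence_preserving A \<Xi> f"
  moreover have "congruence A \<Xi> (induced_preorder A (bool_inf A \<Xi> L))"
    by (intro congruence_induced_preorder bool_inf.preimage bool_inf.compl)
  ultimately have "compatible A (induced_preorder A (bool_inf A \<Xi> L)) (unary_op f)"
    by (simp add: congruence_preserving_def)
  then show "preimage A f L \<in> bool_inf A \<Xi> L"
    using preimage_in_complete_family[OF f bool_inf.base] bool_inf.Union bool_inf.Inter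
    by (metis subsetD)
next
  assume inf: "\<forall>L. L \<subseteq> A \<longrightarrow> preimage A f L \<in> bool_inf A \<Xi> L"
  show "congruence_preserving A \<Xi> f"
    unfolding congruence_preserving_def
  proof (intro allI impI)
    fix \<rho> assume \<rho>: "congruence A \<Xi> \<rho>"
    then have pre: "preorder_on A \<rho>"
      using congruence_imp_stable_preorder by (auto simp: stable_preorder_def)
    show "compatible A \<rho> (unary_op f)"
    proof (rule compatible_unary_opI_upsets[OF pre f])
      fix x
      \<comment> \<open>For a congruence the principal up-set is the class of
        \<open>f x\<close>.\<close>
      have up: "\<rho> `` {f x} \<in> upsets A \<rho>" using upsets_Image_singleton[OF pre] .
      then have "\<rho> `` {f x} \<subseteq> A" by (simp add: upsets_def)
      then show "preimage A f (\<rho> `` {f x}) \<in> upsets A \<rho>"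
        using inf bool_inf_subset_upsets[OF \<rho> up] by blast
    qed
  qed
qed

lemma finite_index_congruence_preserving_iff:
  assumes f: "f \<in> A \<rightarrow> A"
  shows "finite_index_congruence_preserving A \<Xi> f \<longleftrightarrow>
    (\<forall>L. L \<subseteq> A \<and> recognizable A \<Xi> L \<longrightarrow> preimage A f L \<in> bool_fin A \<Xi> L)"
proof (intro iffI allI impI)
  fix L assume pres: "finite_index_congruence_preserving A \<Xi> f"
    and "L \<subseteq> A \<and> recognizable A \<Xi> L"
  then obtain \<theta> where \<theta>: "congruence A \<Xi> \<theta>" "finite (A // \<theta>)" and L: "L \<in> upsets A \<theta>"
    by (auto simp: recognizable_iff finite_index_congruence_def)
  let ?T = "bool_fin A \<Xi> L"
  have equiv: "equiv A \<theta>" using \<theta> by (simp add: congruence_def)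
  have T: "?T \<subseteq> upsets A \<theta>"
    using bool_fin_subset_upsets[OF \<theta>(1) L] .
  have cong: "congruence A \<Xi> (induced_preorder A ?T)"
    by (intro congruence_induced_preorder bool_fin.preimage bool_fin.compl)
  \<comment> \<open>The finiteness lemma counts classes of the relation intersected with its
    converse; by symmetry this is the relation itself.\<close>
  then have "(induced_preorder A ?T)\<inverse> = induced_preorder A ?T"
    by (simp add: congruence_def equiv_def sym_conv_converse_eq)
  then have "finite_index_congruence A \<Xi> (induced_preorder A ?T)"
    using cong finite_index_induced_preorder[OF equiv \<theta>(2) T]
    by (simp add: finite_index_congruence_def)
  then have "compatible A (induced_preorder A ?T) (unary_op f)"
    using pres by (auto simp: finite_index_congruence_preserving_def)
  moreover have "finite ?T"
    using finite_subset[OF T finite_upsets[OF equiv \<theta>(2)]] .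
  ultimately show "preimage A f L \<in> ?T"
    by (rule preimage_in_finite_family[OF f bool_fin.base]) (auto intro: bool_fin.intros)
next
  assume fin: "\<forall>L. L \<subseteq> A \<and> recognizable A \<Xi> L \<longrightarrow> preimage A f L \<in> bool_fin A \<Xi> L"
  show "finite_index_congruence_preserving A \<Xi> f"
    unfolding finite_index_congruence_preserving_def
  proof (intro allI impI)
    fix \<rho> assume \<rho>: "finite_index_congruence A \<Xi> \<rho>"
    then have \<rho>': "congruence A \<Xi> \<rho>" by (simp add: finite_index_congruence_def)
    then have pre: "preorder_on A \<rho>"
      using congruence_imp_stable_preorder by (auto simp: stable_preorder_def)
    show "compatible A \<rho> (unary_op f)"
    proof (rule compatible_unary_opI_upsets[OF pre f])
      fix x
      have up: "\<rho> `` {f x} \<in> upsets A \<rho>" using upsets_Image_singleton[OF pre] .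
      then have "\<rho> `` {f x} \<subseteq> A" by (simp add: upsets_def)
      then show "preimage A f (\<rho> `` {f x}) \<in> upsets A \<rho>"
        using fin bool_fin_subset_upsets[OF \<rho>' up]
          recognizable_Image_singleton[OF finite_index_congruence_imp_stable_preorder[OF \<rho>]]
        by blast
    qed
  qed
qed

end

theorem theorem4p9:
  fixes A :: "'a set" and \<Xi> :: "'a operation set" and f :: "'a \<Rightarrow> 'a"
  assumes "univ_algebra A \<Xi>" and "f \<in> A \<rightarrow> A"
  shows "(stable_preorder_preserving A \<Xi> f \<longleftrightarrow>
            (\<forall>L. L \<subseteq> A \<longrightarrow> preimage A f L \<in> latt_inf A \<Xi> L))
       \<and> (finite_index_stable_preorder_preserving A \<Xi> f \<longleftrightarrow>
            (\<forall>L. L \<subseteq> A \<and> recognizable A \<Xi> L \<longrightarrow> preimage A f L \<in> latt_fin A \<Xi> L))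
       \<and> (congruence_preserving A \<Xi> f \<longleftrightarrow>
            (\<forall>L. L \<subseteq> A \<longrightarrow> preimage A f L \<in> bool_inf A \<Xi> L))
       \<and> (finite_index_congruence_preserving A \<Xi> f \<longleftrightarrow>
            (\<forall>L. L \<subseteq> A \<and> recognizable A \<Xi> L \<longrightarrow> preimage A f L \<in> bool_fin A \<Xi> L))
       \<and> (stable_preorder_preserving A \<Xi> f \<longrightarrow> finite_index_stable_preorder_preserving A \<Xi> f)
       \<and> (stable_preorder_preserving A \<Xi> f \<longrightarrow> congruence_preserving A \<Xi> f)
       \<and> (finite_index_stable_preorder_preserving A \<Xi> f \<longrightarrow> finite_index_congruence_preserving A \<Xi> f)
       \<and> (congruence_preserving A \<Xi> f \<longrightarrow> finite_index_congruence_preserving A \<Xi> f)"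
proof -
  interpret univ_algebra A \<Xi> by fact
  \<comment> \<open>Each of the four implications comes from an inclusion between the classes of
    relations to be preserved.\<close>
  have "stable_preorder_preserving A \<Xi> f \<longrightarrow> finite_index_stable_preorder_preserving A \<Xi> f"
    by (simp add: stable_preorder_preserving_def finite_index_stable_preorder_preserving_def
        finite_index_stable_preorder_def)
  moreover have "stable_preorder_preserving A \<Xi> f \<longrightarrow> congruence_preserving A \<Xi> f"
    by (simp add: stable_preorder_preserving_def congruence_preserving_def
        congruence_imp_stable_preorder)
  moreover have "finite_index_stable_preorder_preserving A \<Xi> f \<longrightarrow>
      finite_index_congruence_preserving A \<Xi> f"
    by (simp add: finite_index_stable_preorder_preserving_def
        finite_index_congruence_preserving_def finite_index_congruence_imp_stable_preorder)
  moreover have "congruence_preserving A \<Xi> f \<longrightarrow> finite_index_congruence_preserving A \<Xi> f"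
    by (simp add: congruence_preserving_def finite_index_congruence_preserving_def
        finite_index_congruence_def)
  ultimately show ?thesis
    using stable_preorder_preserving_iff[OF assms(2)] congruence_preserving_iff[OF assms(2)]
      finite_index_stable_preorder_preserving_iff[OF assms(2)]
      finite_index_congruence_preserving_iff[OF assms(2)]
    by (intro conjI)
qed

end
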